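(* Let $\{X_i\}_{i=1}^\infty$ be an i.i.d. sequence of random variables under a sublinear expectation $\mathbb{E}[\cdot]=\sup_{\theta\in\Theta}E_\theta[\cdot]$. Suppose that $\overline{\mu}=\mathbb{E}[X_1]$ and $\underline{\mu}=-\mathbb{E}[-X_1]$ are both finite, and that $$\overline{\sigma}^2:=\sup_{\theta\in\Theta}E_\theta\big\{[X_1-E_\theta(X_1)]^2\big\}$$ is finite. Let $\overline{X}_n=\sum_{i=1}^n X_i/n$. Then $$\mathbb{E}\Big\{\big[(\overline{X}_n-\overline{\mu})^+\big]^2+\big[(\overline{X}_n-\underline{\mu})^-\big]^2\Big\}\le\frac{2[\overline{\sigma}^2+(\overline{\mu}-\underline{\mu})^2]}{n}.$$
   Context: Let $\{P_\theta:\theta\in\Theta\}$ be a set of probability measures on a measurable space $(\Omega,\mathcal{F})$, and let $E_\theta$ be the expectation under $P_\theta$. For a random variable $X$ such that $E_\theta[X]$ exists for all $\theta\in\Theta$, the sublinear expectation is $\mathbb{E}[X]:=\sup_{\theta\in\Theta}E_\theta[X]$. Two random variables $X,Y$ are identically distributed if $\mathbb{E}[\varphi(X)]=\mathbb{E}[\varphi(Y)]$ for all bounded continuous $\varphi$. A random vector $Y\in\mathbb{R}^n$ is independent of a random vector $X\in\mathbb{R}^m$ if $\mathbb{E}[\varphi(X,Y)]=\mathbb{E}\big\{\{\mathbb{E}[\varphi(x,Y)]\}_{x=X}\big\}$ for all bounded continuous $\varphi:\mathbb{R}^{m+n}\to\mathbb{R}$ (this relation is not symmetric). A sequence $\{X_i\}_{i=1}^\infty$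 is i.i.d. if for each $i\ge1$, $X_{i+1}$ is identically distributed as $X_1$ and independent of $(X_1,\dots,X_i)$. For $a\in\mathbb{R}$, $a^+=\max\{0,a\}$ and $a^-=(-a)^+$. *)

theory Defs
  imports "HOL-Probability.Probability"
begin

text \<open>
  Expectations are taken in the extended reals, as \<open>E[X\<^sup>+] - E[X\<^sup>-]\<close>, so that a non-integrable
  variable does not get the default value \<open>0\<close> of the Bochner integral.  The map \<open>e2ennreal\<close>
  sends negative arguments to \<open>0\<close>, so it is the positive part.  If both parts have infinite
  integral, the expectation does not exist and the value of \<open>ext_expectation\<close> is meaningless.
\<close>

definition ext_expectation :: "'w measure \<Rightarrow> ('w \<Rightarrow> ereal) \<Rightarrow> ereal" where
  "ext_expectation Q X =
     enn2ereal (\<integral>\<^sup>+ w. e2ennreal (X w) \<partial>Q) - enn2ereal (\<integral>\<^sup>+ w. e2ennreal (- X w) \<partial>Q)"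

definition expectation_exists :: "'w measure \<Rightarrow> ('w \<Rightarrow> ereal) \<Rightarrow> bool" where
  "expectation_exists Q X \<longleftrightarrow> X \<in> borel_measurable Q \<and>
     \<not> ((\<integral>\<^sup>+ w. e2ennreal (X w) \<partial>Q) = \<infinity> \<and> (\<integral>\<^sup>+ w. e2ennreal (- X w) \<partial>Q) = \<infinity>)"

lemma ext_expectation_eq_integral:
  fixes X :: "'w \<Rightarrow> real"
  assumes "integrable Q X"
  shows "ext_expectation Q (\<lambda>w. ereal (X w)) = ereal (\<integral>w. X w \<partial>Q)"
proof -
  have fin: "(\<integral>\<^sup>+ w. ennreal (X w) \<partial>Q) < \<infinity>" "(\<integral>\<^sup>+ w. ennreal (- X w) \<partial>Q) < \<infinity>"
    using assms by (auto simp: real_integrable_def top.not_eq_extremum)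
  show ?thesis
    using fin unfolding ext_expectation_def real_lebesgue_integral_def[OF assms]
    by (cases "\<integral>\<^sup>+ w. ennreal (X w) \<partial>Q"; cases "\<integral>\<^sup>+ w. ennreal (- X w) \<partial>Q")
       (auto simp: enn2ereal_ennreal)
qed

definition sublin_expectation ::
  "'p set \<Rightarrow> ('p \<Rightarrow> 'w measure) \<Rightarrow> ('w \<Rightarrow> ereal) \<Rightarrow> ereal" where
  "sublin_expectation \<Theta> P X = (SUP \<theta>\<in>\<Theta>. ext_expectation (P \<theta>) X)"

definition sublin_ident_distrib ::
  "'p set \<Rightarrow> ('p \<Rightarrow> 'w measure) \<Rightarrow> ('w \<Rightarrow> real) \<Rightarrow> ('w \<Rightarrow> real) \<Rightarrow> bool" where
  "sublin_ident_distrib \<Theta> P X Y \<longleftrightarrow>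
     (\<forall>\<phi> :: real \<Rightarrow> real. continuous_on UNIV \<phi> \<and> bounded (range \<phi>) \<longrightarrow>
        sublin_expectation \<Theta> P (\<lambda>w. ereal (\<phi> (X w))) =
        sublin_expectation \<Theta> P (\<lambda>w. ereal (\<phi> (Y w))))"

text \<open>
  \<open>sublin_indep_of \<Theta> P T Y S X\<close>: the random element \<open>Y\<close> of the space \<open>T\<close> is independent of
  the random element \<open>X\<close> of the space \<open>S\<close>.  The relation is not symmetric in \<open>X\<close> and \<open>Y\<close>.
  For random vectors, \<open>S\<close> and \<open>T\<close> are finite powers of the real line, and the product of the
  two spaces plays the role of \<open>\<real>\<^bsup>m+n\<^esup>\<close>.
\<close>

definition sublin_indep_of ::
  "'p set \<Rightarrow> ('p \<Rightarrow> 'w measure) \<Rightarrow> 'b topology \<Rightarrow> ('w \<Rightarrow> 'b) \<Rightarrow> 'a topology \<Rightarrow> ('w \<Rightarrow> 'a) \<Rightarrow> bool" where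
  "sublin_indep_of \<Theta> P T Y S X \<longleftrightarrow>
     (\<forall>\<phi> :: 'a \<times> 'b \<Rightarrow> real.
        continuous_map (prod_topology S T) euclideanreal \<phi> \<and>
        bounded (\<phi> ` topspace (prod_topology S T)) \<longrightarrow>
        sublin_expectation \<Theta> P (\<lambda>w. ereal (\<phi> (X w, Y w))) =
        sublin_expectation \<Theta> P
          (\<lambda>w. sublin_expectation \<Theta> P (\<lambda>w'. ereal (\<phi> (X w, Y w')))))"

text \<open>
  Sequences are indexed from \<open>1\<close>; the value at index \<open>0\<close> is ignored.  The vector
  \<open>(X\<^sub>1, \<dots>, X\<^sub>i)\<close> is an extensional function on \<open>{1..i}\<close>, with the product topology.
\<close>

definition sublin_iid ::
  "'p set \<Rightarrow> ('p \<Rightarrow> 'w measure) \<Rightarrow> (nat \<Rightarrow> 'w \<Rightarrow> real) \<Rightarrow> bool" where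
  "sublin_iid \<Theta> P X \<longleftrightarrow>
     (\<forall>i\<ge>1. sublin_ident_distrib \<Theta> P (X (i + 1)) (X 1) \<and>
        sublin_indep_of \<Theta> P euclideanreal (X (i + 1))
          (powertop_real {1..i}) (\<lambda>w. \<lambda>k\<in>{1..i}. X k w))"

end

theory Submission imports Defs begin

text \<open>
  Let \<open>d\<^sub>n(s)\<close> be the distance from \<open>s\<close> to \<open>[n \<mu>\<^sub>l\<^sub>o, n \<mu>\<^sub>u\<^sub>p]\<close>.  For every \<open>e\<close> in
  \<open>[\<mu>\<^sub>l\<^sub>o, \<mu>\<^sub>u\<^sub>p]\<close>, translating the nearest point of \<open>s\<close> by \<open>e\<close> gives
  \<open>d\<^sub>n\<^sub>+\<^sub>1(s + x)\<^sup>2 \<le> d\<^sub>n(s)\<^sup>2 + 2 c (x - e) + (x - e)\<^sup>2\<close> with \<open>c = \<plusminus>d\<^sub>n(s)\<close>.  Under \<open>P \<theta>\<close> take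
  \<open>e\<close> to be the mean of \<open>X\<^sub>1\<close>: the cross term vanishes, so the sublinear expectation of
  \<open>d\<^sub>n\<^sub>+\<^sub>1(s + X\<^sub>1)\<^sup>2\<close> is at most \<open>d\<^sub>n(s)\<^sup>2 + \<sigma>\<^sup>2\<close>.  Independence turns this into a recursion
  for the partial sums, which gives the sharper bound \<open>\<sigma>\<^sup>2 / n\<close>.  Since independence and identity of
  distribution are tested on bounded functions only, the recursion is run for the truncations
  \<open>min K d\<^sub>n\<^sup>2\<close>, and \<open>K\<close> tends to infinity at the end.
\<close>

section \<open>Monotonicity and truncation of extended expectations\<close>

lemma ext_expectation_mono:
  assumes "\<And>w. X w \<le> Y w"
  shows "ext_expectation Q X \<le> ext_expectation Q Y"
  unfolding ext_expectation_def
  by (intro ereal_minus_mono less_eq_ennreal.rep_eq[THEN iffD1] nn_integral_mono e2ennreal_mono)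
     (auto simp: assms)

lemma sublin_expectation_mono:
  assumes "\<And>w. X w \<le> Y w"
  shows "sublin_expectation \<Theta> P X \<le> sublin_expectation \<Theta> P Y"
  unfolding sublin_expectation_def by (intro SUP_mono') (rule ext_expectation_mono[OF assms])

lemma ext_expectation_nonneg:
  fixes Y :: "'w \<Rightarrow> real"
  assumes "\<And>w. 0 \<le> Y w"
  shows "ext_expectation Q (\<lambda>w. ereal (Y w)) = enn2ereal (\<integral>\<^sup>+ w. ennreal (Y w) \<partial>Q)"
  using assms by (simp add: ext_expectation_def ennreal_neg zero_ennreal.rep_eq)

lemma (in prob_space) integrable_truncation:
  fixes Y :: "'a \<Rightarrow> real"
  assumes "Y \<in> borel_measurable M" "\<And>w. 0 \<le> Y w" "0 \<le> K"
  shows "integrable M (\<lambda>w. min K (Y w))"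
  using assms by (intro integrable_const_bound[where B = K]) auto

text \<open>Monotone convergence along \<open>min k Y\<close>. It recovers the unbounded
  \<open>Y\<close> from bounded test functions, the only ones that independence and identity of
  distribution speak about.\<close>

lemma ext_expectation_le_of_truncations:
  fixes Y :: "'w \<Rightarrow> real"
  assumes "Y \<in> borel_measurable Q" "\<And>w. 0 \<le> Y w"
    and "\<And>k::nat. ext_expectation Q (\<lambda>w. ereal (min (real k) (Y w))) \<le> b"
  shows "ext_expectation Q (\<lambda>w. ereal (Y w)) \<le> b"
proof -
  have "(SUP k::nat. ennreal (min (real k) (Y w))) = ennreal (Y w)" for w
  proof (rule antisym)
    obtain k :: nat where "Y w \<le> real k" using real_arch_simple by blast
    then show "ennreal (Y w) \<le> (SUP k::nat. ennreal (min (real k) (Y w)))"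
      by (intro SUP_upper2[of k]) auto
  qed (auto intro!: SUP_least ennreal_leI)
  then have "(\<integral>\<^sup>+ w. ennreal (Y w) \<partial>Q) = (\<integral>\<^sup>+ w. (SUP k::nat. ennreal (min (real k) (Y w))) \<partial>Q)"
    by simp
  also have "\<dots> = (SUP k::nat. \<integral>\<^sup>+ w. ennreal (min (real k) (Y w)) \<partial>Q)"
    using assms(1)
    by (intro nn_integral_monotone_convergence_SUP) (auto simp: incseq_def le_fun_def intro!: ennreal_leI)
  also have "\<dots> \<le> e2ennreal b"
  proof (rule SUP_least)
    fix k :: nat
    have "enn2ereal (\<integral>\<^sup>+ w. ennreal (min (real k) (Y w)) \<partial>Q) \<le> b"
      using assms(3)[of k] assms(2) by (subst (asm) ext_expectation_nonneg) auto
    from e2ennreal_mono[OF this]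
    show "(\<integral>\<^sup>+ w. ennreal (min (real k) (Y w)) \<partial>Q) \<le> e2ennreal b" by simp
  qed
  finally have "enn2ereal (\<integral>\<^sup>+ w. ennreal (Y w) \<partial>Q) \<le> enn2ereal (e2ennreal b)"
    by (rule less_eq_ennreal.rep_eq[THEN iffD1])
  \<comment> \<open>The truncation at 0 vanishes, so \<open>b\<close> is nonnegative and
    \<open>e2ennreal b\<close> does not clip it.\<close>
  moreover have "0 \<le> b"
    using assms(3)[of 0] assms(2) by (simp add: ext_expectation_nonneg min_absorb1 zero_ennreal.rep_eq)
  ultimately show ?thesis
    using assms(2) by (simp add: ext_expectation_nonneg enn2ereal_e2ennreal)
qed

section \<open>Squared distance from a point to an interval\<close>

definition sqdist :: "real \<Rightarrow> real \<Rightarrow> real \<Rightarrow> real" where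
  "sqdist a b t = (max 0 (t - b))\<^sup>2 + (max 0 (a - t))\<^sup>2"

lemma sqdist_nonneg: "0 \<le> sqdist a b t"
  by (simp add: sqdist_def)

lemma continuous_on_sqdist [continuous_intros]:
  "continuous_on A f \<Longrightarrow> continuous_on A (\<lambda>x. sqdist a b (f x))"
  unfolding sqdist_def by (intro continuous_intros)

lemma measurable_sqdist [measurable]: "sqdist a b \<in> borel_measurable borel"
  by (intro borel_measurable_continuous_onI continuous_intros)

lemma sqdist_le: "a \<le> u \<Longrightarrow> u \<le> b \<Longrightarrow> sqdist a b t \<le> (t - u)\<^sup>2"
proof -
  assume u: "a \<le> u" "u \<le> b"
  consider "b < t" | "t < a" | "a \<le> t" "t \<le> b" by linarith
  then show ?thesis
  proof cases
    case 1
    then show ?thesis using u power_mono[of "t - b" "t - u" 2] by (simp add: sqdist_def max_def)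
  next
    case 2
    then show ?thesis using u power_mono[of "a - t" "u - t" 2]
      by (simp add: sqdist_def max_def power2_commute)
  next
    case 3
    then show ?thesis by (simp add: sqdist_def max_def)
  qed
qed

lemma sqdist_scale:
  assumes "0 \<le> c"
  shows "sqdist (c * a) (c * b) (c * t) = c\<^sup>2 * sqdist a b t"
proof -
  have "max 0 (c * t - c * b) = c * max 0 (t - b)" "max 0 (c * a - c * t) = c * max 0 (a - t)"
    using assms by (auto simp: max_mult_distrib_left right_diff_distrib)
  then show ?thesis by (simp add: sqdist_def power_mult_distrib distrib_left)
qed

text \<open>\<open>c s\<close> is the signed distance from \<open>s\<close> to [a, b], so
  \<open>s - c s\<close> is the nearest point and \<open>s - c s + e\<close> lies in [a + l, b + u].
  Expanding the square of the distance to that point leaves a middle term that has mean zero once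
  \<open>x\<close> is random with mean \<open>e\<close>.\<close>

lemma sqdist_add_le:
  assumes "a \<le> b" "l \<le> e" "e \<le> u"
  defines "c \<equiv> \<lambda>s. max 0 (s - b) - max 0 (a - s)"
  shows "sqdist (a + l) (b + u) (s + x) \<le> sqdist a b s + 2 * c s * (x - e) + (x - e)\<^sup>2"
proof -
  have "sqdist (a + l) (b + u) (s + x) \<le> (s + x - (s - c s + e))\<^sup>2"
    using assms by (intro sqdist_le) (auto simp: c_def max_def)
  also have "\<dots> = (c s)\<^sup>2 + 2 * c s * (x - e) + (x - e)\<^sup>2"
    by (simp add: power2_eq_square algebra_simps)
  also have "(c s)\<^sup>2 = sqdist a b s"
  proof -
    \<comment> \<open>\<open>s\<close> cannot lie both above \<open>b\<close> and below
      \<open>a\<close>, so the cross term of the square is zero.\<close>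
    have "max 0 (s - b) * max 0 (a - s) = 0"
      using assms(1) by (auto simp: max_def)
    then show ?thesis
      unfolding c_def sqdist_def power2_diff by simp
  qed
  finally show ?thesis .
qed

section \<open>Moments of one variable and the one-step bound\<close>

lemma sublin_mean_bounds:
  fixes Y :: "'w \<Rightarrow> real"
  assumes \<theta>: "\<theta> \<in> \<Theta>"
    and ex: "expectation_exists (P \<theta>) (\<lambda>w. ereal (Y w))"
    and mu_up: "sublin_expectation \<Theta> P (\<lambda>w. ereal (Y w)) = ereal mu_up"
    and mu_lo: "- sublin_expectation \<Theta> P (\<lambda>w. - ereal (Y w)) = ereal mu_lo"
  shows "integrable (P \<theta>) Y" "mu_lo \<le> (\<integral>w. Y w \<partial>P \<theta>)" "(\<integral>w. Y w \<partial>P \<theta>) \<le> mu_up"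
proof -
  let ?p = "\<integral>\<^sup>+ w. ennreal (Y w) \<partial>P \<theta>" and ?n = "\<integral>\<^sup>+ w. ennreal (- Y w) \<partial>P \<theta>"
  have up: "ext_expectation (P \<theta>) (\<lambda>w. ereal (Y w)) \<le> ereal mu_up"
    using \<theta> unfolding mu_up[symmetric] sublin_expectation_def by (rule SUP_upper)
  have "ext_expectation (P \<theta>) (\<lambda>w. - ereal (Y w)) \<le> sublin_expectation \<Theta> P (\<lambda>w. - ereal (Y w))"
    using \<theta> unfolding sublin_expectation_def by (rule SUP_upper)
  also have "\<dots> = ereal (- mu_lo)"
    using mu_lo by (metis ereal_uminus_uminus uminus_ereal.simps(1))
  finally have lo: "ext_expectation (P \<theta>) (\<lambda>w. - ereal (Y w)) \<le> ereal (- mu_lo)" .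
  \<comment> \<open>If only the positive part had infinite integral, the mean would be infinite,
    against \<open>up\<close>; if only the negative part had, the mean of \<open>- Y\<close> would
    be, against \<open>lo\<close>. Existence excludes both at once.\<close>
  have "?p \<noteq> \<infinity> \<and> ?n \<noteq> \<infinity>"
    using up lo ex unfolding ext_expectation_def expectation_exists_def
    by (cases ?p; cases ?n) (auto simp: enn2ereal_ennreal)
  then show int: "integrable (P \<theta>) Y"
    using ex unfolding expectation_exists_def by (simp add: real_integrable_def)
  show "mu_lo \<le> (\<integral>w. Y w \<partial>P \<theta>)"
    using lo ext_expectation_eq_integral[of "P \<theta>" "\<lambda>w. - Y w"] int by simp
  show "(\<integral>w. Y w \<partial>P \<theta>) \<le> mu_up"
    using up ext_expectation_eq_integral[OF int] by simp
qed

text \<open>Keeping the truncation on the right makes the bound, as a function of \<open>s\<close>,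
  usable in a recursion at one fixed \<open>K\<close>.\<close>

lemma sublin_truncated_sqdist_step:
  fixes Y :: "'w \<Rightarrow> real"
  assumes prob: "\<And>\<theta>. \<theta> \<in> \<Theta> \<Longrightarrow> prob_space (P \<theta>)"
    and ex: "\<And>\<theta>. \<theta> \<in> \<Theta> \<Longrightarrow> expectation_exists (P \<theta>) (\<lambda>w. ereal (Y w))"
    and mu_up: "sublin_expectation \<Theta> P (\<lambda>w. ereal (Y w)) = ereal mu_up"
    and mu_lo: "- sublin_expectation \<Theta> P (\<lambda>w. - ereal (Y w)) = ereal mu_lo"
    and sigma2: "(SUP \<theta>\<in>\<Theta>. ext_expectation (P \<theta>)
        (\<lambda>w. (ereal (Y w) - ext_expectation (P \<theta>) (\<lambda>w'. ereal (Y w')))\<^sup>2)) = ereal sigma2"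
    and K: "0 \<le> K" and ab: "a \<le> b"
  shows "sublin_expectation \<Theta> P
      (\<lambda>w. ereal (min K (sqdist (a + mu_lo) (b + mu_up) (s + Y w))))
    \<le> ereal (min K (sqdist a b s + sigma2))"
  unfolding sublin_expectation_def
proof (rule SUP_least)
  fix \<theta> assume \<theta>: "\<theta> \<in> \<Theta>"
  interpret prob_space "P \<theta>" using prob[OF \<theta>] .
  note mean = sublin_mean_bounds[OF \<theta> ex[OF \<theta>] mu_up mu_lo]
  note int = mean(1)
  have Ym: "Y \<in> borel_measurable (P \<theta>)"
    using int by (rule borel_measurable_integrable)
  define m where "m = expectation Y"
  have m: "ext_expectation (P \<theta>) (\<lambda>w. ereal (Y w)) = ereal m"
    unfolding m_def by (rule ext_expectation_eq_integral[OF int])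
  \<comment> \<open>The mean \<open>m\<close> lies in [mu_lo, mu_up] and so is an admissible
    \<open>e\<close>. It varies with \<theta>, but the interval on the left does not.\<close>
  have pw: "sqdist (a + mu_lo) (b + mu_up) (s + x) \<le>
      sqdist a b s + 2 * (max 0 (s - b) - max 0 (a - s)) * (x - m) + (x - m)\<^sup>2" for x
    using mean unfolding m_def by (intro sqdist_add_le ab)
  have "ext_expectation (P \<theta>) (\<lambda>w. (ereal (Y w) - ereal m)\<^sup>2) \<le> ereal sigma2"
    unfolding sigma2[symmetric] m[symmetric] using \<theta> by (rule SUP_upper)
  then have v: "ext_expectation (P \<theta>) (\<lambda>w. ereal ((Y w - m)\<^sup>2)) \<le> ereal sigma2"
    by (simp add: power2_eq_square)
  \<comment> \<open>Finiteness of \<open>sigma2\<close> makes the squared deviation integrable, so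
    its Bochner integral is the true variance and not the default 0.\<close>
  then have "(\<integral>\<^sup>+ w. ennreal ((Y w - m)\<^sup>2) \<partial>P \<theta>) < \<infinity>"
    by (cases "\<integral>\<^sup>+ w. ennreal ((Y w - m)\<^sup>2) \<partial>P \<theta>")
       (auto simp: ext_expectation_nonneg)
  then have int2: "integrable (P \<theta>) (\<lambda>w. (Y w - m)\<^sup>2)"
    using Ym by (intro integrableI_nonneg) auto
  have var: "expectation (\<lambda>w. (Y w - m)\<^sup>2) \<le> sigma2"
    using v unfolding ext_expectation_eq_integral[OF int2] by simp
  let ?c = "2 * (max 0 (s - b) - max 0 (a - s))"
  have intK: "integrable (P \<theta>) (\<lambda>w. min K (sqdist (a + mu_lo) (b + mu_up) (s + Y w)))"
    using Ym K
    by (intro integrable_truncation sqdist_nonneg measurable_compose[OF _ measurable_sqdist]) auto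
  have "expectation (\<lambda>w. min K (sqdist (a + mu_lo) (b + mu_up) (s + Y w)))
      \<le> expectation (\<lambda>w. sqdist a b s + ?c * (Y w - m) + (Y w - m)\<^sup>2)"
    using int int2 pw by (intro integral_mono intK) (auto intro: min.coboundedI2)
  \<comment> \<open>\<open>?c\<close> depends on \<open>s\<close> only, so the linear term
    contributes a multiple of \<open>expectation Y - m\<close>, which is zero.\<close>
  also have "\<dots> = sqdist a b s + ?c * (expectation Y - m) + expectation (\<lambda>w. (Y w - m)\<^sup>2)"
    using int int2 by (simp add: prob_space)
  finally have "expectation (\<lambda>w. min K (sqdist (a + mu_lo) (b + mu_up) (s + Y w)))
      \<le> sqdist a b s + sigma2" using var by (simp add: m_def)
  moreover have "expectation (\<lambda>w. min K (sqdist (a + mu_lo) (b + mu_up) (s + Y w))) \<le> K"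
    using integral_mono[OF intK, of "\<lambda>_. K"] by (simp add: prob_space)
  ultimately show "ext_expectation (P \<theta>)
      (\<lambda>w. ereal (min K (sqdist (a + mu_lo) (b + mu_up) (s + Y w))))
      \<le> ereal (min K (sqdist a b s + sigma2))"
    unfolding ext_expectation_eq_integral[OF intK] ereal_less_eq by simp
qed

section \<open>Recursion for truncated squared distances of partial sums\<close>

lemma sublin_truncated_sqdist_sum_le:
  fixes X :: "nat \<Rightarrow> 'w \<Rightarrow> real"
  assumes prob: "\<And>\<theta>. \<theta> \<in> \<Theta> \<Longrightarrow> prob_space (P \<theta>)"
    and rv: "\<And>\<theta> i. \<theta> \<in> \<Theta> \<Longrightarrow> i \<ge> 1 \<Longrightarrow> X i \<in> borel_measurable (P \<theta>)"
    and iid: "sublin_iid \<Theta> P X"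
    and step: "\<And>n s. sublin_expectation \<Theta> P
          (\<lambda>w. ereal (min K (sqdist (real (Suc n) * l) (real (Suc n) * u) (s + X 1 w))))
        \<le> ereal (min K (sqdist (real n * l) (real n * u) s + v))"
    and K: "0 \<le> K" and v: "0 \<le> v"
  shows "sublin_expectation \<Theta> P
      (\<lambda>w. ereal (min K (sqdist (real (Suc n) * l) (real (Suc n) * u) (\<Sum>i=1..Suc n. X i w))))
    \<le> ereal (real (Suc n) * v)"
proof (induction n)
  case 0
  \<comment> \<open>For \<open>n = 0\<close> and \<open>s = 0\<close> the interval on the right of
    \<open>step\<close> is {0}, so that side is \<open>min K v\<close>.\<close>
  show ?case using order_trans[OF step[of 0 0], of "ereal v"] by (simp add: sqdist_def)
next
  case (Suc n)
  let ?G = "\<lambda>n. sqdist (real n * l) (real n * u)"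
  let ?N = "Suc n"
  let ?V = "\<lambda>w. \<lambda>k\<in>{1..?N}. X k w"
  define \<phi> where "\<phi> = (\<lambda>(x::nat \<Rightarrow> real, y). min K (?G (Suc ?N) ((\<Sum>i=1..?N. x i) + y)))"
  \<comment> \<open>With the partial sum frozen at \<open>s\<close>, the new variable may be
    replaced by \<open>X 1\<close>, the variable in \<open>step\<close>.\<close>
  have ident: "sublin_expectation \<Theta> P (\<lambda>w. ereal (min K (?G (Suc ?N) (s + X (Suc ?N) w))))
      = sublin_expectation \<Theta> P (\<lambda>w. ereal (min K (?G (Suc ?N) (s + X 1 w))))" for s
  proof -
    have "sublin_ident_distrib \<Theta> P (X (Suc ?N)) (X 1)"
      using iid by (simp add: sublin_iid_def)
    moreover have "continuous_on UNIV (\<lambda>y. min K (?G (Suc ?N) (s + y)))"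
      by (intro continuous_intros)
    moreover have "bounded (range (\<lambda>y. min K (?G (Suc ?N) (s + y))))"
      using K by (intro boundedI[of _ K]) (auto simp: sqdist_nonneg)
    ultimately show ?thesis
      unfolding sublin_ident_distrib_def by blast
  qed
  have "sublin_indep_of \<Theta> P euclideanreal (X (Suc ?N)) (powertop_real {1..?N}) ?V"
    using iid by (simp add: sublin_iid_def)
  moreover have "continuous_map (prod_topology (powertop_real {1..?N}) euclideanreal) euclideanreal \<phi>"
  proof -
    have "continuous_map (prod_topology (powertop_real {1..?N}) euclideanreal) euclideanreal
        (\<lambda>z. (\<Sum>i=1..?N. fst z i) + snd z)"
    proof (intro continuous_intros)
      fix i assume "i \<in> {1..?N}"
      then show "continuous_map (prod_topology (powertop_real {1..?N}) euclideanreal) euclideanreal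
          (\<lambda>z. fst z i)"
        using continuous_map_compose[OF continuous_map_fst continuous_map_product_projection,
            of i "{1..?N}" "\<lambda>_. euclideanreal"] by (simp add: o_def)
    qed (auto intro: continuous_map_snd)
    moreover have "continuous_map euclideanreal euclideanreal (\<lambda>t. min K (?G (Suc ?N) t))"
      by (simp, intro continuous_intros)
    ultimately have "continuous_map (prod_topology (powertop_real {1..?N}) euclideanreal)
        euclideanreal ((\<lambda>t. min K (?G (Suc ?N) t)) \<circ> (\<lambda>z. (\<Sum>i=1..?N. fst z i) + snd z))"
      by (rule continuous_map_compose)
    then show ?thesis
      unfolding \<phi>_def o_def case_prod_beta .
  qed
  moreover have "bounded (\<phi> ` topspace (prod_topology (powertop_real {1..?N}) euclideanreal))"
    using K by (intro boundedI[of _ K]) (auto simp: \<phi>_def sqdist_nonneg)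
  ultimately have "sublin_expectation \<Theta> P (\<lambda>w. ereal (\<phi> (?V w, X (Suc ?N) w))) =
      sublin_expectation \<Theta> P (\<lambda>w. sublin_expectation \<Theta> P (\<lambda>w'. ereal (\<phi> (?V w, X (Suc ?N) w'))))"
    unfolding sublin_indep_of_def by blast
  moreover have \<phi>V: "\<phi> (?V w, y) = min K (?G (Suc ?N) ((\<Sum>i=1..?N. X i w) + y))" for w y
    by (simp add: \<phi>_def)
  ultimately have "sublin_expectation \<Theta> P (\<lambda>w. ereal (min K (?G (Suc ?N) (\<Sum>i=1..Suc ?N. X i w))))
      = sublin_expectation \<Theta> P (\<lambda>w. sublin_expectation \<Theta> P
          (\<lambda>w'. ereal (min K (?G (Suc ?N) ((\<Sum>i=1..?N. X i w) + X (Suc ?N) w')))))"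
    by simp
  \<comment> \<open>Since \<open>v\<close> is nonnegative it can be moved out of the truncation, and
    the induction hypothesis then applies with the same \<open>K\<close>.\<close>
  also have "\<dots> \<le> sublin_expectation \<Theta> P (\<lambda>w. ereal (min K (?G ?N (\<Sum>i=1..?N. X i w)) + v))"
    unfolding ident
  proof (rule sublin_expectation_mono, rule order_trans[OF step])
    fix w
    show "ereal (min K (?G ?N (\<Sum>i=1..?N. X i w) + v)) \<le> ereal (min K (?G ?N (\<Sum>i=1..?N. X i w)) + v)"
      using v unfolding ereal_less_eq by (auto simp: min_def)
  qed
  also have "\<dots> \<le> ereal (real (Suc ?N) * v)"
    unfolding sublin_expectation_def
  proof (rule SUP_least)
    fix \<theta> assume \<theta>: "\<theta> \<in> \<Theta>"
    interpret prob_space "P \<theta>" using prob[OF \<theta>] .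
    let ?Y = "\<lambda>w. min K (?G ?N (\<Sum>i=1..?N. X i w))"
    have "(\<lambda>w. \<Sum>i=1..?N. X i w) \<in> borel_measurable (P \<theta>)"
      using rv[OF \<theta>] by (intro borel_measurable_sum) simp
    then have int: "integrable (P \<theta>) ?Y"
      using K by (intro integrable_truncation sqdist_nonneg measurable_compose[OF _ measurable_sqdist])
    have "ext_expectation (P \<theta>) (\<lambda>w. ereal (?Y w)) \<le> ereal (real ?N * v)"
      using Suc.IH \<theta> unfolding sublin_expectation_def by (simp add: SUP_le_iff)
    then have "expectation ?Y \<le> real ?N * v"
      by (simp only: ext_expectation_eq_integral[OF int] ereal_less_eq)
    moreover have "integrable (P \<theta>) (\<lambda>w. ?Y w + v)"
      using int by (intro Bochner_Integration.integrable_add integrable_const)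
    moreover have "expectation (\<lambda>w. ?Y w + v) = expectation ?Y + v"
      using int by (subst Bochner_Integration.integral_add) (auto simp: prob_space)
    ultimately show "ext_expectation (P \<theta>) (\<lambda>w. ereal (?Y w + v)) \<le> ereal (real (Suc ?N) * v)"
      by (subst ext_expectation_eq_integral) (auto simp: algebra_simps)
  qed
  finally show ?case .
qed

section \<open>From truncated partial sums to the sample mean\<close>

theorem theorem2p1:
  fixes M :: "'w measure" and \<Theta> :: "'p set" and P :: "'p \<Rightarrow> 'w measure"
    and X :: "nat \<Rightarrow> 'w \<Rightarrow> real" and mu_up mu_lo sigma2 :: real and n :: nat
  assumes prob: "\<And>\<theta>. \<theta> \<in> \<Theta> \<Longrightarrow> prob_space (P \<theta>) \<and> sets (P \<theta>) = sets M"
    and rv: "\<And>i. i \<ge> 1 \<Longrightarrow> X i \<in> borel_measurable M"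
    and iid: "sublin_iid \<Theta> P X"
    and ex: "\<And>\<theta>. \<theta> \<in> \<Theta> \<Longrightarrow> expectation_exists (P \<theta>) (\<lambda>w. ereal (X 1 w))"
    and mu_up: "sublin_expectation \<Theta> P (\<lambda>w. ereal (X 1 w)) = ereal mu_up"
    and mu_lo: "- sublin_expectation \<Theta> P (\<lambda>w. - ereal (X 1 w)) = ereal mu_lo"
    and sigma2: "(SUP \<theta>\<in>\<Theta>. ext_expectation (P \<theta>)
        (\<lambda>w. (ereal (X 1 w) - ext_expectation (P \<theta>) (\<lambda>w'. ereal (X 1 w')))\<^sup>2)) = ereal sigma2"
    and n: "n \<ge> 1"
  shows "sublin_expectation \<Theta> P
      (\<lambda>w. ereal ((max 0 ((\<Sum>i=1..n. X i w) / real n - mu_up))\<^sup>2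
                + (max 0 (- ((\<Sum>i=1..n. X i w) / real n - mu_lo)))\<^sup>2))
    \<le> ereal (2 * (sigma2 + (mu_up - mu_lo)\<^sup>2) / real n)"
proof -
  have P: "prob_space (P \<theta>)" and sets: "sets (P \<theta>) = sets M" if "\<theta> \<in> \<Theta>" for \<theta>
    using prob that by auto
  have rvP: "X i \<in> borel_measurable (P \<theta>)" if "\<theta> \<in> \<Theta>" "i \<ge> 1" for \<theta> i
    using rv[OF that(2)] measurable_cong_sets[OF sets[OF that(1)] refl] by blast
  \<comment> \<open>Over an empty index set the supremum would be minus infinity, which is not
    \<open>ereal sigma2\<close>.\<close>
  obtain \<theta>\<^sub>0 where \<theta>\<^sub>0: "\<theta>\<^sub>0 \<in> \<Theta>"
    using sigma2 by (cases "\<Theta> = {}") (auto simp: bot_ereal_def)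
  note step = sublin_truncated_sqdist_step[OF P ex mu_up mu_lo sigma2]
  have "mu_lo \<le> mu_up"
    using sublin_mean_bounds[OF \<theta>\<^sub>0 ex[OF \<theta>\<^sub>0] mu_up mu_lo] by linarith
  \<comment> \<open>The one-step bound with \<open>K = 1\<close> and \<open>a = b = s = 0\<close>
    puts a nonnegative quantity below \<open>min 1 sigma2\<close>.\<close>
  have "0 \<le> sigma2"
  proof -
    have "0 \<le> ext_expectation (P \<theta>\<^sub>0) (\<lambda>w. ereal (min 1 (sqdist mu_lo mu_up (X 1 w))))"
      by (simp add: ext_expectation_nonneg sqdist_nonneg del: ereal_min)
    also have "\<dots> \<le> sublin_expectation \<Theta> P (\<lambda>w. ereal (min 1 (sqdist mu_lo mu_up (X 1 w))))"
      using \<theta>\<^sub>0 unfolding sublin_expectation_def by (rule SUP_upper)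
    also have "\<dots> \<le> ereal (min 1 (sqdist 0 0 0 + sigma2))"
      using step[of 1 0 0 0] by simp
    finally show ?thesis by (simp add: sqdist_def)
  qed
  have N: "real n > 0" using n by simp
  obtain k where k: "n = Suc k" using n by (cases n) auto
  let ?G = "sqdist (real n * mu_lo) (real n * mu_up)"
  let ?S = "\<lambda>w. \<Sum>i=1..n. X i w"
  have trunc: "sublin_expectation \<Theta> P (\<lambda>w. ereal (min K (?G (?S w)))) \<le> ereal (real n * sigma2)"
    if K: "0 \<le> K" for K
    unfolding k
  proof (rule sublin_truncated_sqdist_sum_le[OF P rvP iid _ K \<open>0 \<le> sigma2\<close>])
    fix j s
    show "sublin_expectation \<Theta> P (\<lambda>w. ereal (min K (sqdist (real (Suc j) * mu_lo)
        (real (Suc j) * mu_up) (s + X 1 w))))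
      \<le> ereal (min K (sqdist (real j * mu_lo) (real j * mu_up) s + sigma2))"
      using step[OF _ _ K, of "real j * mu_lo" "real j * mu_up" s] \<open>mu_lo \<le> mu_up\<close>
      by (simp add: distrib_right add.commute mult_left_mono del: ereal_min)
  qed
  have scale: "(max 0 (?S w / real n - mu_up))\<^sup>2 + (max 0 (- (?S w / real n - mu_lo)))\<^sup>2
      = ?G (?S w) / (real n)\<^sup>2" for w
    using sqdist_scale[of "real n" mu_lo mu_up "?S w / real n"] N
    by (simp add: sqdist_def)
  show ?thesis
    unfolding scale sublin_expectation_def
  proof (rule SUP_least, rule ext_expectation_le_of_truncations)
    fix \<theta> assume \<theta>: "\<theta> \<in> \<Theta>"
    interpret prob_space "P \<theta>" using P[OF \<theta>] .
    have S: "?S \<in> borel_measurable (P \<theta>)"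
      using rvP[OF \<theta>] by (intro borel_measurable_sum) simp
    then show "(\<lambda>w. ?G (?S w) / (real n)\<^sup>2) \<in> borel_measurable (P \<theta>)"
      by (intro borel_measurable_divide measurable_compose[OF S measurable_sqdist]) simp
    show "0 \<le> ?G (?S w) / (real n)\<^sup>2" for w by (simp add: sqdist_nonneg)
    fix m :: nat
    \<comment> \<open>The sum's squared distance is \<open>n^2\<close> times that of the mean, so
      cutting the latter at \<open>m\<close> means cutting the former at \<open>?K\<close>.\<close>
    let ?K = "real m * (real n)\<^sup>2"
    have int: "integrable (P \<theta>) (\<lambda>w. min ?K (?G (?S w)))"
      using S
      by (intro integrable_truncation sqdist_nonneg measurable_compose[OF S measurable_sqdist]) simp
    have "ext_expectation (P \<theta>) (\<lambda>w. ereal (min ?K (?G (?S w)))) \<le> ereal (real n * sigma2)"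
      using trunc[of ?K] \<theta> unfolding sublin_expectation_def by (simp add: SUP_le_iff)
    then have le: "expectation (\<lambda>w. min ?K (?G (?S w))) \<le> real n * sigma2"
      by (simp only: ext_expectation_eq_integral[OF int] ereal_less_eq)
    have eq: "min (real m) (?G (?S w) / (real n)\<^sup>2) = min ?K (?G (?S w)) / (real n)\<^sup>2" for w
      using N by (simp add: min_def field_simps)
    have "expectation (\<lambda>w. min ?K (?G (?S w)) / (real n)\<^sup>2) \<le> real n * sigma2 / (real n)\<^sup>2"
      using le by (simp add: divide_right_mono)
    also have "\<dots> = sigma2 / real n"
      using N by (simp add: power2_eq_square)
    \<comment> \<open>The bound \<open>sigma2 / real n\<close> is weakened to the stated one only
      here, by adding nonnegative terms.\<close>
    also have "\<dots> \<le> 2 * (sigma2 + (mu_up - mu_lo)\<^sup>2) / real n"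
      using \<open>0 \<le> sigma2\<close> N by (intro divide_right_mono) auto
    finally show "ext_expectation (P \<theta>) (\<lambda>w. ereal (min (real m) (?G (?S w) / (real n)\<^sup>2)))
        \<le> ereal (2 * (sigma2 + (mu_up - mu_lo)\<^sup>2) / real n)"
      unfolding eq using int by (subst ext_expectation_eq_integral) auto
  qed
qed

end
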